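(* (a) For every $K_3N$ $n=pqr$, $B<\sqrt2\,\sqrt[4]{n}-\left(\sqrt3-\dfrac12\right)\sqrt[8]{\dfrac n4}+\dfrac{39+\sqrt3}{24}$. (b) For every $C_3N$ $n=pqr$ except $n=6601$, $B<\sqrt2\,\sqrt[4]{n}-\left(\sqrt7-\dfrac12\right)\sqrt[8]{\dfrac n4}+\dfrac{175-3\sqrt7}{56}$.
   Context: A $K_3N$ (Korselt number with three factors) is an integer $n$ together with a factorisation $n=pqr$, where $1<p<q<r$ are odd integers (not necessarily prime) such that each of $p-1,\ q-1,\ r-1$ divides $n-1$, and such that $E:=\dfrac{pq-1}{r-1}$ (which is an integer by the divisibility condition) satisfies $E\ge 2$. A $C_3N$ is a Carmichael number with exactly three prime factors $p<q<r$, i.e. a $K_3N$ $n=pqr$ in which $p,q,r$ are all prime. Put $H:=\gcd(p-1,q-1,r-1)$ and $B:=\frac{q-1}{H}$. *)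

theory Defs
  imports Complex_Main "HOL-Number_Theory.Number_Theory"
begin

text \<open>
  All variables are natural numbers; subtraction never truncates, because the numbers involved
  are at least 1. The division in \<open>E = (p * q - 1) / (r - 1)\<close> is exact: \<open>r - 1\<close> divides
  \<open>p * q * r - 1 = p * q * (r - 1) + (p * q - 1)\<close>; see \<open>K3N_E_exact\<close> below.
\<close>

definition K3N_E :: "nat \<Rightarrow> nat \<Rightarrow> nat \<Rightarrow> nat" where
  "K3N_E p q r = (p * q - 1) div (r - 1)"

definition K3N :: "nat \<Rightarrow> nat \<Rightarrow> nat \<Rightarrow> nat \<Rightarrow> bool" where
  "K3N n p q r \<longleftrightarrow>
     n = p * q * r \<and> 1 < p \<and> p < q \<and> q < r \<and> odd p \<and> odd q \<and> odd r \<and>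
     (p - 1) dvd (n - 1) \<and> (q - 1) dvd (n - 1) \<and> (r - 1) dvd (n - 1) \<and>
     2 \<le> K3N_E p q r"

text \<open>
  Carmichael numbers with exactly three prime factors, taken as the Korselt numbers whose three
  factors are prime; \<open>C3N_iff_carmichael\<close> below shows that this agrees with the
  definition of Carmichael numbers as the composite Fermat pseudoprimes to every coprime base.
\<close>

definition C3N :: "nat \<Rightarrow> nat \<Rightarrow> nat \<Rightarrow> nat \<Rightarrow> bool" where
  "C3N n p q r \<longleftrightarrow> K3N n p q r \<and> prime p \<and> prime q \<and> prime r"

definition K3N_H :: "nat \<Rightarrow> nat \<Rightarrow> nat \<Rightarrow> nat" where
  "K3N_H p q r = gcd (p - 1) (gcd (q - 1) (r - 1))"

definition K3N_B :: "nat \<Rightarrow> nat \<Rightarrow> nat \<Rightarrow> real" where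
  "K3N_B p q r = real (q - 1) / real (K3N_H p q r)"

lemma pqr_minus_1:
  fixes p q r :: nat
  assumes "1 < p" "1 < q" "1 < r"
  shows "p * q * r - 1 = p * q * (r - 1) + (p * q - 1)"
proof -
  have "p * q * r = p * q * (r - 1) + p * q"
    using assms by (metis Suc_pred' add.commute less_trans mult_Suc_right zero_less_one)
  moreover have "p * q \<ge> 1"
    using assms by (simp add: Suc_le_eq)
  ultimately show ?thesis by linarith
qed

lemma r_minus_1_dvd:
  fixes p q r :: nat
  assumes "1 < p" "1 < q" "1 < r" "(r - 1) dvd (p * q * r - 1)"
  shows "(r - 1) dvd (p * q - 1)"
proof -
  have "(r - 1) dvd (p * q * (r - 1) + (p * q - 1))"
    using assms(4) unfolding pqr_minus_1[OF assms(1-3)] .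
  thus ?thesis
    by (subst (asm) dvd_add_right_iff) simp_all
qed

lemma K3N_E_exact:
  assumes "K3N n p q r"
  shows "p * q - 1 = K3N_E p q r * (r - 1)"
  using assms r_minus_1_dvd[of p q r] by (auto simp: K3N_def K3N_E_def)

definition carmichael_number :: "nat \<Rightarrow> bool" where
  "carmichael_number n \<longleftrightarrow>
     1 < n \<and> \<not> prime n \<and> (\<forall>a. coprime a n \<longrightarrow> [a ^ (n - 1) = 1] (mod n))"

lemma fermat_iff_Carmichael_dvd:
  fixes n k :: nat
  assumes "1 < n"
  shows "(\<forall>a. coprime a n \<longrightarrow> [a ^ k = 1] (mod n)) \<longleftrightarrow> Carmichael n dvd k"
proof
  assume *: "\<forall>a. coprime a n \<longrightarrow> [a ^ k = 1] (mod n)"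
  show "Carmichael n dvd k"
    unfolding Carmichael_def
  proof (intro Lcm_least, safe)
    fix a assume "a \<in> totatives n"
    hence "[a ^ k = 1] (mod n)" using * by (simp add: totatives_def)
    thus "ord n a dvd k" using ord_divides by blast
  qed
next
  assume "Carmichael n dvd k"
  thus "\<forall>a. coprime a n \<longrightarrow> [a ^ k = 1] (mod n)"
    using Carmichael_divides by (simp add: coprime_commute)
qed

lemma Carmichael_prime':
  assumes "prime (p::nat)"
  shows "Carmichael p = p - 1"
  using assms prime_primitive_root_exists[of p] residue_primroot_Carmichael[of p]
  by (metis prime_gt_1_nat totient_prime)

lemma C3N_iff_carmichael:
  "C3N n p q r \<longleftrightarrow>
     carmichael_number n \<and> n = p * q * r \<and> prime p \<and> prime q \<and> prime r \<and> p < q \<and> q < r"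
  (is "?L \<longleftrightarrow> ?R")
proof (cases "n = p * q * r \<and> prime p \<and> prime q \<and> prime r \<and> p < q \<and> q < r")
  case True
  hence n: "n = p * q * r" and pr: "prime p" "prime q" "prime r" and lt: "p < q" "q < r"
    by auto
  have gt: "1 < p" "1 < q" "1 < r" using pr prime_gt_1_nat by auto
  have cop: "coprime p q" "coprime p r" "coprime q r"
    using pr lt by (simp_all add: primes_coprime)
  have "coprime (p * q) r" using cop by simp
  hence car: "Carmichael n = lcm (lcm (p - 1) (q - 1)) (r - 1)"
    unfolding n using cop pr by (simp add: Carmichael_mult_coprime Carmichael_prime')
  have n1: "1 < n" unfolding n using gt by (metis less_1_mult)
  have np: "\<not> prime n" unfolding n using gt
    by (metis less_1_mult less_not_refl2 nat_mult_eq_1_iff prime_product)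
  have C: "carmichael_number n \<longleftrightarrow>
      (p - 1) dvd (n - 1) \<and> (q - 1) dvd (n - 1) \<and> (r - 1) dvd (n - 1)"
    unfolding carmichael_number_def using n1 np fermat_iff_Carmichael_dvd[OF n1, of "n - 1"] car
    by (simp add: lcm_least_iff)
  have odds: "odd p \<and> odd q \<and> odd r" if d: "(q - 1) dvd (n - 1)"
  proof -
    have "2 < q" "2 < r" using gt lt by auto
    hence o: "odd q" "odd r" using pr prime_odd_nat by auto
    hence "even (q - 1)" by simp
    hence "even (n - 1)" using d dvd_trans by blast
    hence "odd n" using n1 by simp
    with o n show ?thesis by simp
  qed
  have E2: "2 \<le> K3N_E p q r" if d: "(r - 1) dvd (n - 1)"
  proof -
    have "(r - 1) dvd (p * q - 1)"
      using d n gt r_minus_1_dvd[of p q r] by simp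
    hence e: "p * q - 1 = K3N_E p q r * (r - 1)" by (simp add: K3N_E_def)
    have pq: "1 < p * q" using gt by (metis less_1_mult)
    have "K3N_E p q r \<noteq> 0" by (rule notI) (use e pq in simp)
    moreover have "K3N_E p q r \<noteq> 1"
    proof
      assume "K3N_E p q r = 1"
      hence "p * q - 1 = r - 1" using e by simp
      hence "p * q = r" using pq gt(3) by linarith
      hence "prime (p * q)" using pr by simp
      thus False using gt prime_product[of p q] by linarith
    qed
    ultimately show ?thesis by linarith
  qed
  show ?thesis
    unfolding C3N_def K3N_def C using True gt(1) odds E2 by metis
next
  case False
  thus ?thesis by (auto simp: C3N_def K3N_def)
qed

end

theory Submission
  imports Defs
begin

text \<open>
  Write $p - 1 = HA$, $q - 1 = HB$, $r - 1 = HC$ with $A, B, C$ pairwise coprime. The divisibility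
  conditions give $EC = HAB + A + B$ and $MAB = H(A + B) + E + 1$, that is, $KB = p + E$ with
  $K = MA - H \ge 1$. Moreover $nE > p^2 q^2$. Unless $K = M = 1$ this already yields
  $3B^4 < 5n$, which is better than the leading term $B^4 < 4n$ of the claim by enough to absorb
  the lower order terms.

  If $K = M = 1$, then $A = H + 1$, $p = H^2 + H + 1$, and with $B = 2p - v$, $C = 2p + v + k$ one
  finds $v(v + k) = kp - A$, so that $v \approx \sqrt k H$ and $(n/4)^{1/8} \approx H + 3/8$.
  The bound with $\sqrt k$ in place of $\sqrt 3$ or $\sqrt 7$ is then an expansion in $1/H$, and
  it remains to exclude $k = 1, 2$ in general and $k = 3, \dots, 6$ for primes. For each $k$ the
  relation between $v$ and $H$ is a Pell-type equation, which is treated by congruences or descent.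
\<close>

section \<open>Integer parameters of a Korselt number with three factors\<close>

text \<open>The conditions on \<open>p - 1\<close> and \<open>q - 1\<close> involve
  \<open>C\<close>; multiplying by \<open>E\<close> and substituting
  \<open>E * C = H * A * B + A + B\<close> removes it. Then \<open>A\<close> and \<open>B\<close>
  both divide \<open>H * (A + B) + E + 1\<close>, and so does their product, with quotient
  \<open>M\<close>.\<close>

lemma K3N_parameters:
  assumes "K3N n p q r"
  obtains H A B C E M :: int
  where "int p = H * A + 1" "int q = H * B + 1" "int r = H * C + 1"
    "even H" "0 < H" "0 < A" "A < B" "B < C" "coprime A B"
    "E * C = H * A * B + A + B" "2 \<le> E" "E \<le> H * A"
    "M * (A * B) = H * (A + B) + E + 1"
    "K3N_B p q r = of_int B"
proof -
  define H where "H = K3N_H p q r"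
  from assms have n: "n = p * q * r" and lt: "1 < p" "p < q" "q < r"
    and od: "odd p" "odd q" "odd r"
    and dv: "(p - 1) dvd (n - 1)" "(q - 1) dvd (n - 1)" "(r - 1) dvd (n - 1)"
    and E2: "2 \<le> K3N_E p q r" by (auto simp: K3N_def)
  have Hd: "H dvd p - 1" "H dvd q - 1" "H dvd r - 1"
    unfolding H_def K3N_H_def by (auto intro: dvd_trans[OF gcd_dvd2])
  then obtain A B C where ABC: "p - 1 = H * A" "q - 1 = H * B" "r - 1 = H * C"
    by (auto elim!: dvdE)
  hence p: "p = H * A + 1" and q: "q = H * B + 1" and r: "r = H * C + 1" using lt by linarith+
  have evH: "even H" unfolding H_def K3N_H_def using od by (auto intro!: gcd_greatest)
  have H0: "H > 0" and A0: "A > 0" using p lt by (auto intro!: gr0I)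
  have AB: "A < B" and BC: "B < C" using lt p q r H0 by auto
  have E: "p * q - 1 = K3N_E p q r * (r - 1)" by (rule K3N_E_exact[OF assms])
  define E where "E = K3N_E p q r"
  have "H * (E * C) = H * (H * A * B + A + B)"
    using E unfolding E_def[symmetric] ABC unfolding p q by (simp add: algebra_simps)
  hence EC: "E * C = H * A * B + A + B" using H0 by simp
  \<comment> \<open>As \<open>C\<close> is at least \<open>B + 1\<close>, a larger \<open>E\<close>
    would push \<open>E * C\<close> above \<open>H * A * B + A + B\<close>.\<close>
  have ub: "E \<le> H * A"
  proof (rule ccontr)
    assume "\<not> E \<le> H * A"
    hence "(H * A + 1) * (B + 1) \<le> E * C" using BC by (intro mult_mono) auto
    moreover have "(H * A + 1) * (B + 1) = H * A * B + H * A + B + 1" by (simp add: algebra_simps)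
    moreover have "A \<le> H * A" using H0 by simp
    ultimately show False using EC by linarith
  qed
  have B_dvd: "B dvd H * A * C + A + C"
  proof -
    have "n = p * r * q" unfolding n by simp
    hence "(q - 1) dvd (p * r - 1)"
      using dv(2) lt r_minus_1_dvd[of p r q] by simp
    moreover have "p * r - 1 = H * (H * A * C + A + C)"
      unfolding p r by (simp add: algebra_simps)
    ultimately show ?thesis using H0 ABC by simp
  qed
  have A_dvd: "A dvd H * B * C + B + C"
  proof -
    have "n = q * r * p" unfolding n by simp
    hence "(p - 1) dvd (q * r - 1)"
      using dv(1) lt r_minus_1_dvd[of q r p] by simp
    moreover have "q * r - 1 = H * (H * B * C + B + C)"
      unfolding q r by (simp add: algebra_simps)
    ultimately show ?thesis using H0 ABC by simp
  qed
  \<comment> \<open>By \<open>B_dvd\<close>, a common divisor \<open>d\<close> of \<open>A\<close>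
    and \<open>B\<close> also divides \<open>C\<close>, so \<open>H * d\<close> divides the gcd
    \<open>H\<close>.\<close>
  have cop: "coprime A B"
  proof (rule coprimeI)
    fix d assume d: "d dvd A" "d dvd B"
    have "d dvd H * A * C + A + C" using d B_dvd dvd_trans by blast
    hence dC: "d dvd C" using d by (simp add: dvd_add_right_iff)
    hence "H * d dvd p - 1" "H * d dvd q - 1" "H * d dvd r - 1"
      using d ABC by simp_all
    hence "H * d dvd H" unfolding H_def K3N_H_def by (intro gcd_greatest)
    thus "d dvd 1" using H0 by simp
  qed
  have "B dvd E * (H * A * C + A + C)" using B_dvd by simp
  also have "E * (H * A * C + A + C) = H * A * (E * C) + E * A + E * C" by (simp add: algebra_simps)
  also have "\<dots> = A * (H * A + E + 1) + B * (H * A * (H * A + 1) + H * A + 1)"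
    unfolding EC by (simp add: algebra_simps)
  finally have "B dvd A * (H * A + E + 1)" by (simp add: dvd_add_left_iff)
  hence "B dvd H * A + E + 1" using cop coprime_dvd_mult_right_iff[of B A] by (simp only: coprime_commute)
  hence B1: "B dvd H * (A + B) + E + 1"
    using dvd_add[of B "H * A + E + 1" "H * B"] by (simp add: algebra_simps)
  have "A dvd E * (H * B * C + B + C)" using A_dvd by simp
  also have "E * (H * B * C + B + C) = H * B * (E * C) + E * B + E * C" by (simp add: algebra_simps)
  also have "\<dots> = B * (H * B + E + 1) + A * (H * B * (H * B + 1) + H * B + 1)"
    unfolding EC by (simp add: algebra_simps)
  finally have "A dvd B * (H * B + E + 1)" by (simp add: dvd_add_left_iff)
  hence "A dvd H * B + E + 1" using cop coprime_dvd_mult_right_iff[of A B] by (simp only:)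
  hence A1: "A dvd H * (A + B) + E + 1"
    using dvd_add[of A "H * B + E + 1" "H * A"] by (simp add: algebra_simps)
  have "A * B dvd H * (A + B) + E + 1" using A1 B1 cop by (rule divides_mult)
  then obtain M where M: "H * (A + B) + E + 1 = A * B * M" by (elim dvdE)
  show ?thesis
  proof (rule that[of "int H" "int A" "int B" "int C" "int E" "int M"])
    show "int E * int C = int H * int A * int B + int A + int B"
      using arg_cong[OF EC, of int] by simp
    show "int M * (int A * int B) = int H * (int A + int B) + int E + 1"
      using arg_cong[OF M, of int] by (simp add: algebra_simps)
    show "K3N_B p q r = of_int (int B)"
      unfolding K3N_B_def H_def[symmetric] ABC using H0 by simp
    show "int E \<le> int H * int A" using ub by (metis of_nat_le_iff of_nat_mult)
  qed (use p q r evH H0 A0 AB BC cop E2 in \<open>auto simp: E_def\<close>)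
qed

section \<open>The case where \<open>K\<close> and \<open>M\<close> are not both 1\<close>

text \<open>Here \<open>E * r = p * q - 1 + E\<close>, which exceeds \<open>p * q\<close> because
  \<open>E\<close> is at least 2.\<close>

lemma cofactor_product_bound:
  fixes p q r H A B C E :: int
  assumes "p = H * A + 1" "q = H * B + 1" "r = H * C + 1"
    and "E * C = H * A * B + A + B" "2 \<le> E" "0 < p * q"
  shows "(p * q)\<^sup>2 < p * q * r * E"
proof -
  have "E * r = H * (E * C) + E" unfolding assms(3) by (simp add: algebra_simps)
  also have "\<dots> = p * q - 1 + E" unfolding assms(4) unfolding assms(1,2) by (simp add: algebra_simps)
  finally have "p * q < r * E" using assms(5) by (simp add: mult.commute)
  hence "(p * q) * (p * q) < (p * q) * (r * E)" using assms(6) by (intro mult_strict_left_mono)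
  thus ?thesis by (simp add: power2_eq_square mult.assoc)
qed

text \<open>Everything reduces to \<open>key\<close>: multiplied by \<open>B\<^sup>2\<close>, its
  right side is at most \<open>5 * (p * q)\<^sup>2\<close> because \<open>H * B < q\<close>, and
  \<open>cofactor_product_bound\<close> then lets \<open>E\<close> cancel.\<close>

lemma nonextremal_bound:
  fixes p q r H A B C E M K :: int
  assumes pqr: "p = H * A + 1" "q = H * B + 1" "r = H * C + 1"
    and H: "even H" "0 < H" and A: "0 < A" "A < B"
    and E: "E * C = H * A * B + A + B" "2 \<le> E" "E \<le> H * A"
    and K: "K * B = p + E" "M * A = H + K"
    and ne: "K \<noteq> 1 \<or> M \<noteq> 1"
  shows "3 * B ^ 4 < 5 * (p * q * r)"
proof -
  have H2: "2 \<le> H" using H by presburger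
  have p0: "0 < p" unfolding pqr using H A by simp
  have K1: "1 \<le> K"
  proof (rule ccontr)
    assume "\<not> 1 \<le> K"
    hence "K * B \<le> 0" using A by (simp add: mult_nonpos_nonneg)
    thus False using K(1) p0 E(2) by linarith
  qed
  have M1: "1 \<le> M"
  proof (rule ccontr)
    assume "\<not> 1 \<le> M"
    hence "M * A \<le> 0" using A by (simp add: mult_nonpos_nonneg)
    thus False using K(2) K1 H by linarith
  qed
  have AHK: "A \<le> H + K" using mult_right_mono[OF M1, of A] A K(2) by simp
  have key: "3 * (B\<^sup>2 * E) \<le> 5 * (p\<^sup>2 * H\<^sup>2)"
  proof -
    consider "K \<ge> 3" | "K = 2" | "K = 1" using K1 by linarith
    then show ?thesis
    proof cases
      case 1
      \<comment> \<open>This gives \<open>K * B <= 2 * p\<close>; the gain of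
        \<open>K\<^sup>2\<close> outweighs the growth of \<open>p\<close> permitted by
        \<open>A <= H + K\<close>.\<close>
      have "E \<le> p" using E(3) pqr(1) by linarith
      hence "(K * B)\<^sup>2 * E \<le> (2 * p)\<^sup>2 * p"
        unfolding K(1) using E(2) p0 by (intro mult_mono power_mono) auto
      hence "K\<^sup>2 * (B\<^sup>2 * E) \<le> p\<^sup>2 * (4 * p)"
        by (simp add: power_mult_distrib mult_ac)
      hence a: "3 * (K\<^sup>2 * (B\<^sup>2 * E)) \<le> p\<^sup>2 * (12 * p)" by linarith
      have "12 * p \<le> 5 * K\<^sup>2 * H\<^sup>2"
      proof -
        have p': "p \<le> H\<^sup>2 + H * K + 1"
          using mult_left_mono[OF AHK, of H] H pqr by (simp add: power2_eq_square algebra_simps)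
        have "0 \<le> (H - 2) * (K - 3)" using H2 1 by simp
        hence HK: "H * K \<ge> 3 * H + 2 * K - 6" by (simp add: algebra_simps)
        hence HK6: "H * K \<ge> 6" using H2 1 by linarith
        have "3 * H \<le> H * K" using 1 H by simp
        hence "(3 * H)\<^sup>2 \<le> (H * K)\<^sup>2" using H by (intro power_mono) auto
        hence "9 * H\<^sup>2 \<le> (H * K)\<^sup>2" by (simp only: power_mult_distrib) simp
        moreover have "6 * (H * K) \<le> (H * K)\<^sup>2"
          using mult_right_mono[OF HK6, of "H*K"] HK6 by (simp add: power2_eq_square)
        moreover have "5 * K\<^sup>2 * H\<^sup>2 = 5 * (H * K)\<^sup>2" by (simp add: power_mult_distrib)
        ultimately show ?thesis using p' HK6 by linarith
      qed
      hence "p\<^sup>2 * (12 * p) \<le> p\<^sup>2 * (5 * K\<^sup>2 * H\<^sup>2)" by (intro mult_left_mono) auto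
      with a have "K\<^sup>2 * (3 * (B\<^sup>2 * E)) \<le> K\<^sup>2 * (5 * (p\<^sup>2 * H\<^sup>2))" by (simp add: mult_ac)
      thus ?thesis using 1 by simp
    next
      case 2
      \<comment> \<open>For \<open>H >= 4\<close>, \<open>A <= H + 2\<close> implies
        \<open>3 * A <= 5 * H\<close>, which is enough; \<open>H = 2\<close> leaves four values of
        \<open>A\<close> to check.\<close>
      have "2 * B < 2 * p" using K(1) E(3) pqr(1) unfolding 2 by linarith
      hence "B \<le> H * A" using pqr(1) by linarith
      hence "B\<^sup>2 * E \<le> (H * A)\<^sup>2 * (H * A)"
        using A E H by (intro mult_mono power_mono) auto
      hence b: "3 * (B\<^sup>2 * E) \<le> 3 * (H * A) ^ 3" by (simp add: power2_eq_square power3_eq_cube)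
      show ?thesis
      proof (cases "H = 2")
        case True
        with AHK 2 have "A \<in> {1, 2, 3, 4}" using A by auto
        thus ?thesis using b True pqr(1) by (auto simp: mult.commute)
      next
        case False
        with H2 have "H \<ge> 3" by simp
        hence "H \<ge> 4" using H by presburger
        hence "3 * A \<le> 5 * H" using AHK 2 by linarith
        hence "(H ^ 3 * A\<^sup>2) * (3 * A) \<le> (H ^ 3 * A\<^sup>2) * (5 * H)"
          using H A by (intro mult_left_mono) auto
        hence "3 * (H * A) ^ 3 \<le> 5 * ((H * A)\<^sup>2 * H\<^sup>2)"
          by (simp add: power2_eq_square power3_eq_cube mult_ac)
        also have "\<dots> \<le> 5 * (p\<^sup>2 * H\<^sup>2)"
          using H A pqr by (intro mult_left_mono mult_right_mono power_mono) auto
        finally show ?thesis using b by linarith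
      qed
    next
      case 3
      hence B: "B = p + E" using K by simp
      have MA: "M * A = H + 1" using K 3 by simp
      \<comment> \<open>An odd \<open>M\<close> other than 1 is at least 3, so \<open>A\<close> is
        at most about a third of \<open>H\<close>.\<close>
      hence "odd M" using H by (metis even_mult_iff even_plus_one_iff)
      moreover have "M \<noteq> 1" using ne 3 by simp
      ultimately have "M \<ge> 3" using M1 by presburger
      hence "3 * A \<le> H + 1" using MA A by (metis mult_right_mono order_less_imp_le)
      show ?thesis
      proof (cases "H = 2")
        case True
        hence "A = 1" using A \<open>3 * A \<le> H + 1\<close> by simp
        hence "p = 3" "E = 2" "B = 5" using pqr True E B by auto
        thus ?thesis using True by simp
      next
        case False
        with H2 have "H \<ge> 3" by simp
        hence "H \<ge> 4" using H by presburger
        hence "12 * A \<le> 5 * H" using \<open>3 * A \<le> H + 1\<close> by linarith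
        hence c: "H * (12 * A) \<le> H * (5 * H)" using H by (intro mult_left_mono) auto
        have "B \<le> 2 * p" using B E(3) pqr(1) by linarith
        hence "B\<^sup>2 * E \<le> (2 * p)\<^sup>2 * (H * A)"
          using A E(2,3) by (intro mult_mono power_mono) auto
        hence "3 * (B\<^sup>2 * E) \<le> p\<^sup>2 * (H * (12 * A))" by (simp add: power2_eq_square mult_ac)
        also have "\<dots> \<le> p\<^sup>2 * (H * (5 * H))" by (intro mult_left_mono[OF c]) simp
        finally show ?thesis by (simp add: power2_eq_square mult_ac)
      qed
    qed
  qed
  have q0: "0 < q" unfolding pqr using H A by simp
  have "E * (3 * B ^ 4) = B\<^sup>2 * (3 * (B\<^sup>2 * E))"
    by (simp add: power2_eq_square power4_eq_xxxx mult_ac)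
  also have "\<dots> \<le> B\<^sup>2 * (5 * (p\<^sup>2 * H\<^sup>2))" by (intro mult_left_mono key) auto
  also have "\<dots> = 5 * (p * (H * B))\<^sup>2" by (simp add: power_mult_distrib mult_ac)
  also have "\<dots> \<le> 5 * (p * q)\<^sup>2"
    using p0 H A pqr by (intro mult_left_mono power_mono) auto
  also have "\<dots> < 5 * (p * q * r * E)"
    using cofactor_product_bound[OF pqr E(1,2)] p0 q0 by simp
  finally have "E * (3 * B ^ 4) < E * (5 * (p * q * r))" by (simp add: mult_ac)
  thus ?thesis using E(2) by simp
qed

section \<open>Pell-type equations for small \<open>k\<close>\<close>

lemma quadratic_mod:
  fixes a b c x m :: int
  shows "(a * x\<^sup>2 + b * x + c) mod m = (a * (x mod m)\<^sup>2 + b * (x mod m) + c) mod m"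
  by (intro mod_add_cong mod_mult_cong refl) (simp_all add: power_mod)

lemma no_square_between:
  fixes s w :: int
  assumes "0 \<le> s" "s\<^sup>2 < w\<^sup>2" "w\<^sup>2 < (s + 1)\<^sup>2"
  shows False
proof -
  have "\<bar>s\<bar> < \<bar>w\<bar>" "\<bar>w\<bar> < \<bar>s + 1\<bar>"
    using assms(2,3) abs_le_square_iff[of w s] abs_le_square_iff[of "s + 1" w] by linarith+
  thus False using assms(1) by linarith
qed

text \<open>The square \<open>H\<^sup>2\<close> would lie strictly between consecutive
  squares.\<close>

lemma extremal_k_not_1:
  fixes H v :: int
  assumes "v * (v + 1) = H\<^sup>2" "1 \<le> v" "0 < H"
  shows False
proof -
  have "v\<^sup>2 < H\<^sup>2" "H\<^sup>2 < (v + 1)\<^sup>2"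
    using assms by (simp_all add: power2_eq_square algebra_simps)
  hence "v < H" "H < v + 1" using assms by (auto dest: power2_less_imp_less)
  thus False by simp
qed

text \<open>Completing squares gives \<open>8 * x\<^sup>2 = y\<^sup>2 + 15\<close>. As 8 is a
  nonresidue modulo 5, both \<open>x\<close> and \<open>y\<close> are multiples of 5, but 25 does
  not divide 15.\<close>

lemma extremal_k_not_2:
  fixes H v :: int
  assumes "v * (v + 2) = 2 * (H\<^sup>2 + H + 1) - (H + 1)"
  shows False
proof -
  have e: "8 * (v + 1)\<^sup>2 = (4 * H + 1)\<^sup>2 + 15"
    using assms by (simp add: power2_eq_square algebra_simps)
  have *: "5 dvd x \<and> 5 dvd y" if "8 * x\<^sup>2 = y\<^sup>2 + 15" for x y :: int
  proof -
    have "(8 * (x mod 5)\<^sup>2) mod 5 = ((y mod 5)\<^sup>2 + 15) mod 5"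
      using quadratic_mod[of 8 x 0 0 5] quadratic_mod[of 1 y 0 15 5] that by simp
    moreover have "x mod 5 \<in> {0,1,2,3,4}" "y mod 5 \<in> {0,1,2,3,4}" by auto
    ultimately have "x mod 5 = 0 \<and> y mod 5 = 0" by auto
    thus ?thesis by auto
  qed
  from *[OF e] obtain a b where "v + 1 = 5 * a" "4 * H + 1 = 5 * b" by (auto elim!: dvdE)
  with e have "25 * (8 * a\<^sup>2 - b\<^sup>2) = 15" by (simp add: power_mult_distrib)
  thus False by presburger
qed

text \<open>Here 5 is a nonresidue modulo 3 and the constant is 189 = 9 * 21. Factors of 3 can be
  removed from both unknowns once, and a second time 9 would have to divide 21.\<close>

lemma extremal_k_not_5:
  fixes H v :: int
  assumes "v * (v + 5) = 5 * (H\<^sup>2 + H + 1) - (H + 1)"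
  shows False
proof -
  have e: "5 * (2 * v + 5)\<^sup>2 = (10 * H + 4)\<^sup>2 + 189"
    using assms by (simp add: power2_eq_square algebra_simps)
  have *: "3 dvd x \<and> 3 dvd y" if "5 * x\<^sup>2 = y\<^sup>2 + 3 * c" for x y c :: int
  proof -
    have "(5 * (x mod 3)\<^sup>2) mod 3 = ((y mod 3)\<^sup>2) mod 3"
      using quadratic_mod[of 5 x 0 0 3] quadratic_mod[of 1 y 0 "3 * c" 3] that by simp
    moreover have "x mod 3 \<in> {0,1,2}" "y mod 3 \<in> {0,1,2}" by auto
    ultimately have "x mod 3 = 0 \<and> y mod 3 = 0" by auto
    thus ?thesis by auto
  qed
  from *[of _ _ 63] e obtain a b where "2 * v + 5 = 3 * a" "10 * H + 4 = 3 * b"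
    by (fastforce elim!: dvdE)
  with e have e2: "5 * a\<^sup>2 = b\<^sup>2 + 3 * 7" by (simp add: power_mult_distrib)
  from *[OF e2] obtain c d where "a = 3 * c" "b = 3 * d" by (auto elim!: dvdE)
  with e2 have "9 * (5 * c\<^sup>2 - d\<^sup>2) = 21" by (simp add: power_mult_distrib)
  thus False by presburger
qed

text \<open>The square \<open>(v + 2)\<^sup>2\<close> lies strictly between those of
  \<open>2 * H\<close> and \<open>2 * H + 3\<close>, so only two candidates remain.\<close>

lemma extremal_k_4:
  fixes H v :: int
  assumes "v * (v + 4) = 4 * (H\<^sup>2 + H + 1) - (H + 1)" "1 \<le> v" "0 < H"
  shows "H = 6 \<and> v = 11"
proof -
  have e: "(v + 2)\<^sup>2 = 4 * H\<^sup>2 + 3 * H + 7"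
    using assms(1) by (simp add: power2_eq_square algebra_simps)
  have "(2 * H)\<^sup>2 < (v + 2)\<^sup>2" "(v + 2)\<^sup>2 < (2 * H + 3)\<^sup>2"
    unfolding e using assms(3) by (simp_all add: power2_eq_square algebra_simps)
  hence "2 * H < v + 2" "v + 2 < 2 * H + 3"
    using assms(2,3) power2_less_imp_less[of "2 * H" "v + 2"]
      power2_less_imp_less[of "v + 2" "2 * H + 3"] by auto
  hence "v + 2 = 2 * H + 1 \<or> v + 2 = 2 * H + 2" by linarith
  thus ?thesis
  proof
    assume "v + 2 = 2 * H + 1"
    hence v: "v = 2 * H - 1" by simp
    show ?thesis using e unfolding v by (simp add: power2_eq_square algebra_simps)
  next
    assume "v + 2 = 2 * H + 2"
    with e have "5 * H = 3" by (simp add: power2_eq_square algebra_simps)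
    thus ?thesis by presburger
  qed
qed

text \<open>Descent by the unit $49 + 20\sqrt 6$ of $\mathbb{Z}[\sqrt 6]$, whose square root
  $5 + 2\sqrt 6$ does not respect the congruences on the solutions.\<close>

lemma no_even_solution_k_6:
  fixes H w :: int
  assumes "w\<^sup>2 = 6 * H\<^sup>2 + 5 * H + 14" "even H" "0 \<le> H" "0 \<le> w"
  shows False
  using assms
proof (induction "nat H" arbitrary: H w rule: less_induct)
  case less
  note e = less.prems(1)
  show False
  proof (cases "H < 49")
    case True
    obtain h where h: "H = 2 * h" using less.prems(2) by (elim evenE)
    \<comment> \<open>\<open>T\<close> pairs each \<open>h\<close> with the integer square root of
      the right-hand side. The list starts at 0 because the descent may end there.\<close>
    define T :: "(int \<times> int) list" where
      "T = [(0, 3), (1, 6), (2, 11), (3, 16), (4, 20), (5, 25), (6, 30), (7, 35), (8, 40),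
        (9, 45), (10, 50), (11, 55), (12, 59), (13, 64), (14, 69), (15, 74), (16, 79),
        (17, 84), (18, 89), (19, 94), (20, 99), (21, 103), (22, 108), (23, 113), (24, 118)]"
    have T: "\<forall>(i, s)\<in>set T. 0 \<le> s \<and> s\<^sup>2 < 24 * i\<^sup>2 + 10 * i + 14 \<and> 24 * i\<^sup>2 + 10 * i + 14 < (s + 1)\<^sup>2"
      unfolding T_def by simp
    have "map fst T = [0..24]" unfolding T_def by (simp add: upto_rec1[of 0] upto_rec1[of 1])
    hence "set (map fst T) = set [0..24]" by (rule arg_cong)
    hence "fst ` set T = {0..24}" by (simp only: set_map set_upto)
    hence "h \<in> fst ` set T" using h True less.prems(3) by simp
    then obtain i where i: "(h, i) \<in> set T" by auto
    have "w\<^sup>2 = 24 * h\<^sup>2 + 10 * h + 14" using e h by (simp add: power_mult_distrib)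
    with bspec[OF T i] have "0 \<le> i" "i\<^sup>2 < w\<^sup>2" "w\<^sup>2 < (i + 1)\<^sup>2" by simp_all
    thus False by (rule no_square_between)
  next
    case False
    have HH: "49 * H \<le> H\<^sup>2"
      unfolding power2_eq_square using False by (intro mult_right_mono) auto
    \<comment> \<open>These come from multiplying \<open>12 * H + 5 + 2 * w * sqrt 6\<close> by
      \<open>49 - 20 * sqrt 6\<close>, of norm 1. The threshold 49 ensures
      \<open>20 * w < 49 * H + 21\<close>, hence a nonnegative \<open>H0\<close>.\<close>
    define H0 where "H0 = 49 * H + 20 - 20 * w"
    define w0 where "w0 = 49 * w - 120 * H - 50"
    have "w0\<^sup>2 - (6 * H0\<^sup>2 + 5 * H0 + 14) = w\<^sup>2 - (6 * H\<^sup>2 + 5 * H + 14)"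
      unfolding H0_def w0_def by (simp add: power2_eq_square algebra_simps)
    hence eq: "w0\<^sup>2 = 6 * H0\<^sup>2 + 5 * H0 + 14" using e by simp
    have "(20 * w)\<^sup>2 < (49 * H + 21)\<^sup>2"
      using e HH False by (simp add: power2_sum power_mult_distrib)
    hence "20 * w < 49 * H + 21" by (rule power2_less_imp_less) (use less.prems(3,4) in simp)
    hence H0: "0 \<le> H0" unfolding H0_def by simp
    have "(48 * H + 20)\<^sup>2 < (20 * w)\<^sup>2"
      using False HH by (simp add: power2_sum power_mult_distrib e)
    hence "48 * H + 20 < 20 * w" by (rule power2_less_imp_less) (use less.prems(3,4) in simp)
    hence H1: "nat H0 < nat H" unfolding H0_def using False by simp
    have "(120 * H + 50)\<^sup>2 < (49 * w)\<^sup>2"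
      using False HH by (simp add: power2_sum power_mult_distrib e)
    hence "120 * H + 50 < 49 * w" by (rule power2_less_imp_less) (use less.prems(3,4) in simp)
    hence "0 \<le> w0" unfolding w0_def by simp
    moreover have "even H0" using less.prems unfolding H0_def by simp
    ultimately show False using less.hyps[OF H1 eq] H0 by simp
  qed
qed

text \<open>Descent by the unit $7 + 4\sqrt 3$ of $\mathbb{Z}[\sqrt 3]$; every even positive solution
  lies in the orbit of $(H, w) = (2, 9)$, which has period 4 modulo 7.\<close>

lemma solution_k_3_mod_7:
  fixes H w :: int
  assumes "w\<^sup>2 = 12 * H\<^sup>2 + 8 * H + 17" "even H" "0 < H" "0 \<le> w"
  shows "H mod 7 \<in> {2, 5, 6}"
  using assms
proof (induction "nat H" arbitrary: H w rule: less_induct)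
  case less
  note e = less.prems(1)
  show ?case
  proof (cases "H < 34")
    case True
    obtain h where h: "H = 2 * h" using less.prems(2) by (elim evenE)
    show ?thesis
    proof (cases "h = 1")
      case True
      thus ?thesis using h by simp
    next
      case False
      \<comment> \<open>Integer square roots again; the list starts at 2 since \<open>h = 1\<close>
        is the base solution.\<close>
      define T :: "(int \<times> int) list" where
        "T = [(2, 15), (3, 22), (4, 29), (5, 36), (6, 42), (7, 49), (8, 56), (9, 63), (10, 70),
          (11, 77), (12, 84), (13, 91), (14, 98), (15, 105), (16, 112)]"
      have T: "\<forall>(i, s)\<in>set T. 0 \<le> s \<and> s\<^sup>2 < 48 * i\<^sup>2 + 16 * i + 17 \<and> 48 * i\<^sup>2 + 16 * i + 17 < (s + 1)\<^sup>2"
        unfolding T_def by simp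
      have "map fst T = [2..16]" unfolding T_def by simp
      hence "set (map fst T) = set [2..16]" by (rule arg_cong)
      hence "fst ` set T = {2..16}" by (simp only: set_map set_upto)
      hence "h \<in> fst ` set T" using h True False less.prems(3) by simp
      then obtain i where i: "(h, i) \<in> set T" by auto
      have "w\<^sup>2 = 48 * h\<^sup>2 + 16 * h + 17" using e h by (simp add: power_mult_distrib)
      with bspec[OF T i] have "0 \<le> i" "i\<^sup>2 < w\<^sup>2" "w\<^sup>2 < (i + 1)\<^sup>2" by simp_all
      hence False by (rule no_square_between)
      thus ?thesis ..
    qed
  next
    case False
    have HH: "34 * H \<le> H\<^sup>2"
      unfolding power2_eq_square using False by (intro mult_right_mono) auto
    \<comment> \<open>These come from multiplying \<open>6 * H + 2 + w * sqrt 3\<close> by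
      \<open>7 - 4 * sqrt 3\<close>. The threshold 34 ensures \<open>2 * w <= 7 * H\<close>, hence a
      positive \<open>H0\<close>.\<close>
    define H0 where "H0 = 7 * H + 2 - 2 * w"
    define w0 where "w0 = 7 * w - 24 * H - 8"
    have "w0\<^sup>2 - (12 * H0\<^sup>2 + 8 * H0 + 17) = w\<^sup>2 - (12 * H\<^sup>2 + 8 * H + 17)"
      unfolding H0_def w0_def by (simp add: power2_eq_square algebra_simps)
    hence eq: "w0\<^sup>2 = 12 * H0\<^sup>2 + 8 * H0 + 17" using e by simp
    have H: "H = 7 * H0 + 2 + 2 * w0" unfolding H0_def w0_def by simp
    have "(2 * w)\<^sup>2 \<le> (7 * H)\<^sup>2"
      using e HH False by (simp add: power_mult_distrib)
    hence "2 * w \<le> 7 * H" by (rule power2_le_imp_le) (use less.prems(3) in simp)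
    hence H0: "0 < H0" unfolding H0_def by simp
    have "(6 * H + 2)\<^sup>2 < (2 * w)\<^sup>2"
      using False HH by (simp add: power2_sum power_mult_distrib e)
    hence "6 * H + 2 < 2 * w" by (rule power2_less_imp_less) (use less.prems(3,4) in simp)
    hence H1: "nat H0 < nat H" unfolding H0_def using False by simp
    have "(24 * H + 8)\<^sup>2 < (7 * w)\<^sup>2"
      using False HH by (simp add: power2_sum power_mult_distrib e)
    hence "24 * H + 8 < 7 * w" by (rule power2_less_imp_less) (use less.prems(3,4) in simp)
    hence "0 \<le> w0" unfolding w0_def by simp
    moreover have "even H0" using less.prems unfolding H0_def by simp
    ultimately have IH: "H0 mod 7 \<in> {2, 5, 6}" using less.hyps[OF H1 eq] H0 by simp
    define a b where "a = H0 mod 7" and "b = w0 mod 7"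
    \<comment> \<open>Residue 2 of \<open>H0\<close> forces \<open>b\<close> to be 2 or 5, and
      residues 5 and 6 force 0; \<open>2 * b + 2\<close> then lies in the same set of
      residues.\<close>
    have "b\<^sup>2 mod 7 = (12 * a\<^sup>2 + 8 * a + 17) mod 7"
      unfolding a_def b_def
      using quadratic_mod[of 1 w0 0 0 7] quadratic_mod[of 12 H0 8 17 7] eq by simp
    moreover have "b \<in> {0,1,2,3,4,5,6}" unfolding b_def by auto
    moreover have "a \<in> {2,5,6}" unfolding a_def by (rule IH)
    ultimately have "b \<in> {0,2,5}" by auto
    moreover have "H mod 7 = (2 * b + 2) mod 7"
      using quadratic_mod[of 0 w0 2 2 7] mod_mult_self1[of "2 * w0 + 2" H0 7]
      unfolding b_def H by (simp add: add_ac mult_ac)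
    ultimately show ?thesis by auto
  qed
qed

section \<open>The extremal family and the admissible values of \<open>k\<close>\<close>

text \<open>Here \<open>v\<close> is the gap \<open>p - E\<close>, and \<open>k\<close> is chosen so
  that \<open>B + C = 4 * p + k\<close>. Positivity of \<open>k\<close> follows from
  \<open>k * E = v\<^sup>2 + A\<close>.\<close>

lemma extremal_parameters:
  fixes p H A B C E :: int
  assumes "p = H * A + 1" "A = H + 1" "B = p + E" "0 < H"
    and E: "E * C = H * A * B + A + B" "2 \<le> E" "E \<le> H * A"
  obtains v k where "1 \<le> v" "1 \<le> k" "p = H\<^sup>2 + H + 1" "B = 2 * p - v" "C = 2 * p + v + k"
    "v * (v + k) = k * (H\<^sup>2 + H + 1) - (H + 1)"
proof -
  define v where "v = p - E"
  define k where "k = C - 3 * p + E"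
  have v: "1 \<le> v" unfolding v_def using assms(1) E(3) by linarith
  have p: "p = H\<^sup>2 + H + 1" unfolding assms(1,2) by (simp add: power2_eq_square algebra_simps)
  have "E * C = B * p + A" unfolding E(1) assms(1) by (simp add: algebra_simps)
  hence EC: "E * C = (p + E) * p + A" unfolding assms(3) .
  have "v * (v + k) = p * k + ((p + E) * p - E * C)"
    unfolding v_def k_def by (simp add: algebra_simps)
  hence rel: "v * (v + k) = k * p - A" unfolding EC by (simp add: mult.commute)
  have "k * E = k * p - k * v" unfolding v_def by (simp add: algebra_simps)
  hence kE: "k * E = v\<^sup>2 + A" using rel by (simp add: power2_eq_square algebra_simps)
  have "1 \<le> k"
  proof (rule ccontr)
    assume "\<not> 1 \<le> k"
    hence "k * E \<le> 0" using E(2) by (simp add: mult_nonpos_nonneg)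
    thus False using kE assms(2,4) zero_le_power2[of v] by linarith
  qed
  moreover have "B = 2 * p - v" unfolding assms(3) v_def by simp
  moreover have "C = 2 * p + v + k" unfolding v_def k_def by simp
  ultimately show ?thesis using v p rel[unfolded p assms(2)] by (intro that)
qed

text \<open>The values 1, 2 and 5 of \<open>k\<close> are excluded without any primality assumption.
  The smallest one left is 3, the source of \<open>sqrt 3\<close> in the first bound.\<close>

lemma K3N_cases:
  assumes "K3N n p q r"
  obtains (generic) B :: int where "K3N_B p q r = of_int B" "3 * B ^ 4 < 5 * int n"
  | (extremal) H B C v k :: int where
    "K3N_B p q r = of_int B" "even H" "2 \<le> H" "coprime (H + 1) B"
    "int p = H\<^sup>2 + H + 1" "int q = H * B + 1" "int r = H * C + 1" "1 \<le> v" "3 \<le> k" "k \<noteq> 5"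
    "B = 2 * int p - v" "C = 2 * int p + v + k" "v * (v + k) = k * (H\<^sup>2 + H + 1) - (H + 1)"
proof -
  from assms have n: "int n = int p * int q * int r" by (simp add: K3N_def)
  from K3N_parameters[OF assms] obtain H A B C E M :: int where
    pqr: "int p = H * A + 1" "int q = H * B + 1" "int r = H * C + 1"
    and H: "even H" "0 < H" and A: "0 < A" "A < B" and "B < C" and cop: "coprime A B"
    and E: "E * C = H * A * B + A + B" "2 \<le> E" "E \<le> H * A"
    and M: "M * (A * B) = H * (A + B) + E + 1"
    and B: "K3N_B p q r = of_int B" by metis
  define K where "K = M * A - H"
  have K: "K * B = int p + E" "M * A = H + K"
    unfolding K_def pqr using M by (simp_all add: algebra_simps)
  show ?thesis
  proof (cases "K = 1 \<and> M = 1")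
    case False
    hence "3 * B ^ 4 < 5 * int n"
      unfolding n using nonextremal_bound[OF pqr H A E K] by blast
    with B show ?thesis by (rule generic)
  next
    case True
    hence A': "A = H + 1" and B': "B = int p + E" using K by auto
    obtain v k where v: "1 \<le> v" "1 \<le> k" "int p = H\<^sup>2 + H + 1" "B = 2 * int p - v"
      "C = 2 * int p + v + k" and rel: "v * (v + k) = k * (H\<^sup>2 + H + 1) - (H + 1)"
      using extremal_parameters[OF pqr(1) A' B' H(2) E] by metis
    have "k \<noteq> 1" using extremal_k_not_1[of v H] rel v H by auto
    moreover have "k \<noteq> 2" using extremal_k_not_2[of v H] rel by auto
    ultimately have "3 \<le> k" using v(2) by linarith
    moreover have "k \<noteq> 5" using extremal_k_not_5[of v H] rel by auto
    moreover have "2 \<le> H" using H by presburger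
    ultimately show ?thesis
      using B H(1) cop[unfolded A'] v(1,3,4,5) rel pqr(2,3) by (intro extremal)
  qed
qed

text \<open>For \<open>k = 3\<close>, according to \<open>H\<close> modulo 7, the prime 7 divides
  \<open>p\<close>, or \<open>q\<close>, or both \<open>H + 1\<close> and \<open>B\<close>. For
  \<open>k = 4\<close> the only solution has composite \<open>q\<close>, and for
  \<open>k = 6\<close> there is none with even \<open>H\<close>.\<close>

lemma extremal_primes:
  fixes H B C v k p q r :: int
  assumes pr: "prime p" "prime q" and H: "even H" "2 \<le> H" and cop: "coprime (H + 1) B"
    and pqr: "p = H\<^sup>2 + H + 1" "q = H * B + 1" "r = H * C + 1" and v: "1 \<le> v" "3 \<le> k" "k \<noteq> 5"
    and BC: "B = 2 * p - v" "C = 2 * p + v + k"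
    and rel: "v * (v + k) = k * (H\<^sup>2 + H + 1) - (H + 1)"
    and ne: "p * q * r \<noteq> 6601" and pq: "p < q"
  shows "7 \<le> k"
proof -
  have "k \<noteq> 3"
  proof
    assume k: "k = 3"
    define w where "w = 2 * v + 3"
    have w: "w\<^sup>2 = 12 * H\<^sup>2 + 8 * H + 17"
      using rel unfolding w_def k by (simp add: power2_eq_square algebra_simps)
    define h where "h = H div 7"
    have eq: "H = 7 * h + i" if "H mod 7 = i" for i
      unfolding h_def that[symmetric] by simp
    have "H mod 7 \<in> {2, 5, 6}"
      by (rule solution_k_3_mod_7[OF w H(1)]) (use H(2) v(1) in \<open>simp_all add: w_def\<close>)
    then consider "H = 7 * h + 2" | "H = 7 * h + 5" | "H = 7 * h + 6" using eq by blast
    thus False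
    proof cases
      case 1
      have "p = 7 * (7 * h\<^sup>2 + 5 * h + 1)"
        unfolding pqr 1 by (simp add: power2_eq_square algebra_simps)
      hence "7 dvd p" by simp
      hence "p = 7" using primes_dvd_imp_eq[of 7 p] pr(1) by simp
      have "(H - 2) * (H + 3) = 0"
        using \<open>p = 7\<close> unfolding pqr by (simp add: power2_eq_square algebra_simps)
      hence "H = 2" using H by auto
      have "(v - 3) * (v + 6) = 0" using rel unfolding k \<open>H = 2\<close> by (simp add: algebra_simps)
      hence "v = 3" using v by auto
      \<comment> \<open>These values give 7 * 23 * 41 = 6601, the exceptional number.\<close>
      show False using ne BC pqr unfolding \<open>H = 2\<close> \<open>v = 3\<close> k by simp
    next
      case 2
      have "w\<^sup>2 = 7 * (84 * h\<^sup>2 + 128 * h + 51)"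
        unfolding w 2 by (simp add: power2_eq_square algebra_simps)
      hence "7 dvd w\<^sup>2" by simp
      hence "7 dvd w" by (rule prime_dvd_power[rotated]) simp
      then obtain z where z: "w = 7 * z" by (elim dvdE)
      hence v2: "2 * v = 7 * z - 3" unfolding w_def by simp
      have "2 * q = H * (4 * (H\<^sup>2 + H + 1) - 2 * v) + 2"
        unfolding pqr(2) BC(1) pqr(1) by (simp add: algebra_simps)
      also have "\<dots> = 7 * (196 * h^3 + 448 * h\<^sup>2 + 347 * h + 91 - z * H)"
        unfolding v2 unfolding 2 by (simp add: power2_eq_square power3_eq_cube algebra_simps)
      finally have "7 dvd 2 * q" by simp
      hence "7 dvd q" by presburger
      hence "q = 7" using primes_dvd_imp_eq[of 7 q] pr(2) by simp
      moreover have "2 * 2 \<le> H\<^sup>2" using H unfolding power2_eq_square by (intro mult_mono) auto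
      ultimately show False using pq H unfolding pqr(1) by simp
    next
      case 3
      have "w\<^sup>2 = 7 * (84 * h\<^sup>2 + 152 * h + 71)"
        unfolding w 3 by (simp add: power2_eq_square algebra_simps)
      hence "7 dvd w\<^sup>2" by simp
      hence "7 dvd w" by (rule prime_dvd_power[rotated]) simp
      then obtain z where z: "w = 7 * z" by (elim dvdE)
      hence v2: "2 * v = 7 * z - 3" unfolding w_def by simp
      have "2 * B = 4 * (H\<^sup>2 + H + 1) - 2 * v"
        unfolding BC(1) pqr(1) by (simp add: algebra_simps)
      also have "\<dots> = 7 * (28 * h\<^sup>2 + 52 * h + 25 - z)"
        unfolding v2 3 by (simp add: power2_eq_square algebra_simps)
      finally have "7 dvd 2 * B" by simp
      hence "7 dvd B" by presburger
      moreover have "7 dvd H + 1" unfolding 3 by simp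
      ultimately have "is_unit (7 :: int)" using cop by (intro coprime_common_divisor)
      thus False by simp
    qed
  qed
  moreover have "k \<noteq> 4"
  proof
    assume k: "k = 4"
    hence "H = 6 \<and> v = 11" using extremal_k_4[of v H] rel v H by simp
    hence q: "q = 11 * 41" unfolding pqr BC by simp
    hence "11 dvd q" by simp
    hence "q = 11" using primes_dvd_imp_eq[of 11 q] pr(2) by simp
    thus False using q by simp
  qed
  moreover have "k \<noteq> 6"
  proof
    assume k: "k = 6"
    have "(v + 3)\<^sup>2 = 6 * H\<^sup>2 + 5 * H + 14"
      using rel unfolding k by (simp add: power2_eq_square algebra_simps)
    thus False by (rule no_even_solution_k_6[OF _ H(1)]) (use H(2) v(1) in simp_all)
  qed
  ultimately show ?thesis using v by linarith
qed

section \<open>Real estimates in terms of the eighth root of \<open>n / 4\<close>\<close>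

text \<open>This turns both claimed bounds into quadratic polynomials in
  \<open>root 8 (n / 4)\<close>.\<close>

lemma sqrt2_root4_eq:
  assumes "0 \<le> x"
  shows "sqrt 2 * root 4 x = 2 * (root 8 (x / 4))\<^sup>2"
proof -
  have "root 8 (x / 4) = sqrt (root 4 (x / 4))"
    using real_root_mult_exp[of 2 4 "x / 4"] by (simp add: sqrt_def)
  hence "(root 8 (x / 4))\<^sup>2 = root 4 (x / 4)" using assms by simp
  also have "\<dots> = root 4 x / root 4 4" by (simp add: real_root_divide)
  also have "root 4 4 = sqrt 2"
    using real_root_mult_exp[of 2 2 4] real_sqrt_abs[of 2] by (simp add: sqrt_def)
  finally have "root 4 x = sqrt 2 * (root 8 (x / 4))\<^sup>2" by (simp add: field_simps)
  thus ?thesis by (simp flip: mult.assoc)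
qed

text \<open>The constant 1.607 is just above the fourth root of 20/3, so
  \<open>b < 1.607 * x\<^sup>2\<close>. The remaining quadratic
  \<open>0.393 * x\<^sup>2 - c * x + d\<close> is positive because
  \<open>c\<^sup>2 < 4 * 0.393 * d\<close>.\<close>

lemma generic_real_bound:
  fixes b n c d :: real
  assumes b: "3 * b ^ 4 < 5 * n" and n: "0 \<le> n" and c: "c\<^sup>2 < 393 / 250 * d"
  shows "b < 2 * (root 8 (n / 4))\<^sup>2 - c * root 8 (n / 4) + d"
proof -
  define x where "x = root 8 (n / 4)"
  have x: "0 \<le> x" "x ^ 8 = n / 4" unfolding x_def using n by simp_all
  have "3 * b ^ 4 < 20 * x ^ 8" using b x by simp
  also have "\<dots> \<le> 3 * (1607 / 1000 * x\<^sup>2) ^ 4"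
    using x n by (simp add: power_mult_distrib field_simps flip: power_mult)
  finally have "b ^ 4 < (1607 / 1000 * x\<^sup>2) ^ 4" by simp
  hence "b < 1607 / 1000 * x\<^sup>2" by (rule power_less_imp_less_base) simp
  moreover have "0 < (393 / 500 * x - c)\<^sup>2 + (393 / 250 * d - c\<^sup>2)"
    using c by (intro add_nonneg_pos) auto
  hence "0 < 393 / 1000 * x\<^sup>2 - c * x + d"
    by (simp add: power2_eq_square algebra_simps)
  ultimately show ?thesis unfolding x_def[symmetric] by linarith
qed

text \<open>The lower bound for \<open>n\<close> is its value at \<open>k = m\<close>. The
  polynomial \<open>s\<close> splits the comparison into \<open>y ^ 4 <= s\<close> and
  \<open>4 * s\<^sup>2 <= n\<close>, which avoids expanding an eighth power.\<close>

lemma extremal_root_lower_bound: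
  fixes H b m n :: real
  defines "u \<equiv> (33 + 4 * m) / 128 / H - b / H\<^sup>2"
  defines "p \<equiv> H\<^sup>2 + H + 1"
  assumes H: "2 \<le> H" and mb: "m = 3 \<and> b = 3 / 16 \<or> m = 7 \<and> b = 3 / 8"
    and n: "p * (H\<^sup>2 * (4 * p\<^sup>2 + m * p + (H + 1)) + H * (4 * p + m) + 1) \<le> n"
  shows "H + 3 / 8 + u \<le> root 8 (n / 4)"
proof -
  define y where "y = H + 3 / 8 + u"
  define Y where "Y = 128 * H ^ 3 + 48 * H\<^sup>2 + (33 + 4 * m) * H - 128 * b"
  \<comment> \<open>the polynomial part of the square root of the lower bound for \<open>n / 4\<close>\<close>
  define s where "s = H ^ 4 + 3 / 2 * H ^ 3 + (15 + m) / 8 * H\<^sup>2 + (21 + m) / 16 * H + (22 - m) / 32"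
  have y: "128 * H\<^sup>2 * y = Y"
    unfolding y_def u_def Y_def using H
    by (simp add: field_simps power2_eq_square power3_eq_cube)
  have H2: "2 * H \<le> H\<^sup>2" using H by (simp add: power2_eq_square)
  \<comment> \<open>With this, the signs of the explicit polynomials below become a matter of linear
    arithmetic in the powers of \<open>H\<close>.\<close>
  have pw: "2 * H ^ k \<le> H ^ Suc k" for k
    using H by (auto intro: mult_right_mono)
  have "0 \<le> (128 * H\<^sup>2) ^ 4 * s - Y ^ 4"
    using mb
  proof (elim disjE conjE)
    assume mb: "m = 3" "b = 3 / 16"
    have "(128 * H\<^sup>2) ^ 4 * s - Y ^ 4 =
        122683392 * H ^ 9 + 22249472 * H ^ 8 + 128065536 * H ^ 7
        + 38596608 * H ^ 6 + 44546112 * H ^ 5 - 23882769 * H ^ 4 + 895968 * H ^ 3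
        - 4344192 * H ^ 2 + 2488320 * H - 331776"
      unfolding Y_def s_def mb by (simp add: eval_nat_numeral algebra_simps)
    thus ?thesis using H H2 pw[of 2] pw[of 3] pw[of 4] pw[of 5] pw[of 6] pw[of 7] pw[of 8] by simp
  next
    assume mb: "m = 7" "b = 3 / 8"
    have "(128 * H\<^sup>2) ^ 4 * s - Y ^ 4 =
        240123904 * H ^ 9 - 8159232 * H ^ 8 + 444211200 * H ^ 7
        + 58839040 * H ^ 6 + 141845568 * H ^ 5 - 158693713 * H ^ 4 + 19250112 * H ^ 3
        - 30205440 * H ^ 2 + 26984448 * H - 5308416"
      unfolding Y_def s_def mb by (simp add: eval_nat_numeral algebra_simps)
    thus ?thesis using H H2 pw[of 2] pw[of 3] pw[of 4] pw[of 5] pw[of 6] pw[of 7] pw[of 8] by simp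
  qed
  hence "Y ^ 4 \<le> (128 * H\<^sup>2) ^ 4 * s" by simp
  hence "(128 * H\<^sup>2) ^ 4 * y ^ 4 \<le> (128 * H\<^sup>2) ^ 4 * s"
    unfolding y[symmetric] by (simp only: power_mult_distrib)
  hence ys: "y ^ 4 \<le> s" using H by simp
  have "4 * s\<^sup>2 \<le> p * (H\<^sup>2 * (4 * p\<^sup>2 + m * p + (H + 1)) + H * (4 * p + m) + 1)" (is "_ \<le> ?N")
    using mb
  proof (elim disjE conjE)
    assume "m = 3"
    hence "?N - 4 * s\<^sup>2 = 7 / 8 * H ^ 3 + 5 / 16 * H ^ 2 + 7 / 8 * H - 105 / 256"
      unfolding p_def s_def by (simp add: eval_nat_numeral algebra_simps)
    thus ?thesis using H H2 pw[of 2] pw[of 3] by simp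
  next
    assume "m = 7"
    hence "?N - 4 * s\<^sup>2 = 23 / 8 * H ^ 3 + 87 / 16 * H ^ 2 + 87 / 16 * H + 31 / 256"
      unfolding p_def s_def by (simp add: eval_nat_numeral algebra_simps)
    thus ?thesis using H H2 pw[of 2] pw[of 3] by simp
  qed
  hence "s\<^sup>2 \<le> n / 4" using n by simp
  moreover have "(y ^ 4)\<^sup>2 \<le> s\<^sup>2" using ys by (intro power_mono) auto
  ultimately have "y ^ 8 \<le> n / 4" by (simp flip: power_mult)
  hence "root 8 (y ^ 8) \<le> root 8 (n / 4)" by simp
  moreover have "y \<le> root 8 (y ^ 8)"
    by (cases "0 \<le> y") (auto simp: real_root_power_cancel intro: order_trans[of _ 0])
  ultimately show ?thesis unfolding y_def by linarith
qed

text \<open>Here $H + 3/8 + u$ is the expansion of the eighth root of $n/4$ up to order $H^{-1}$; the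
  constants $b$ and $\delta$ absorb the errors of order $H^{-2}$ in the root and $H^{-1}$ in $v$.\<close>

lemma extremal_real_bound:
  fixes H m v b \<delta> x :: real
  defines "u \<equiv> (33 + 4 * m) / 128 / H - b / H\<^sup>2"
  assumes H: "2 \<le> H" and m: "1 \<le> m" and v: "0 \<le> v"
    and rel: "m * (H\<^sup>2 + H + 1) - (H + 1) \<le> v * (v + m)"
    and x: "H + 3 / 8 + u \<le> x" and c: "sqrt m - 1 / 2 \<le> 4 * (H + 3 / 8 + u)"
    and d: "0 \<le> \<delta>" "2 * sqrt m * \<delta> * (1 + (m - 1) / (4 * m)) + \<delta>\<^sup>2 / 4
              \<le> m\<^sup>2 / 4 + m - 1 - (m - 1)\<^sup>2 / (4 * m)"
    and pos: "0 < (\<delta> - 4 * b) / H + (2 - sqrt m) * u + 2 * u\<^sup>2"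
  shows "2 * (H\<^sup>2 + H + 1) - v
           < 2 * x\<^sup>2 - (sqrt m - 1 / 2) * x + (1 / 2 + 3 * m / 8 - sqrt m * (1 / 8 - 1 / (2 * m)))"
proof -
  define s where "s = sqrt m"
  \<comment> \<open>This shift completes the square:
    \<open>m * (H\<^sup>2 + H + 1) - (H + 1)\<close> differs from \<open>m * (H + g)\<^sup>2\<close>
    by a constant.\<close>
  define g where "g = (m - 1) / (2 * m)"
  have s: "0 \<le> s" "s\<^sup>2 = m" unfolding s_def using m by simp_all
  have g: "0 \<le> g" "2 * m * g = m - 1" unfolding g_def using m by simp_all
  have "(s * (H + g) + \<delta> / H)\<^sup>2 = s\<^sup>2 * (H + g)\<^sup>2 + 2 * s * \<delta> * (1 + g / H) + \<delta>\<^sup>2 / H\<^sup>2"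
    using H by (simp add: power2_eq_square field_simps)
  \<comment> \<open>In the error terms \<open>H\<close> is replaced by its least value 2, which
    leads to the expression bounded in \<open>d\<close>.\<close>
  also have "\<dots> \<le> s\<^sup>2 * (H + g)\<^sup>2 + 2 * s * \<delta> * (1 + g / 2) + \<delta>\<^sup>2 / 2\<^sup>2"
    using s g d H by (intro add_mono mult_left_mono divide_left_mono power_mono order_refl) auto
  also have "\<dots> \<le> m * (H + g)\<^sup>2 + (m\<^sup>2 / 4 + m - 1 - m * g\<^sup>2)"
  proof -
    have "(m - 1)\<^sup>2 / (4 * m) = m * g\<^sup>2" "(m - 1) / (4 * m) = g / 2"
      unfolding g_def using m by (simp_all add: power2_eq_square field_simps)
    with d(2) have "2 * s * \<delta> * (1 + g / 2) + \<delta>\<^sup>2 / 4 \<le> m\<^sup>2 / 4 + m - 1 - m * g\<^sup>2"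
      unfolding s_def[symmetric] by simp
    thus ?thesis unfolding s(2) by simp
  qed
  also have "\<dots> = m * (H\<^sup>2 + H + 1) - (H + 1) + m\<^sup>2 / 4"
  proof -
    have "m * (H + g)\<^sup>2 = m * H\<^sup>2 + (2 * m * g) * H + m * g\<^sup>2"
      by (simp add: power2_eq_square algebra_simps)
    thus ?thesis unfolding g(2) by (simp add: algebra_simps)
  qed
  also have "\<dots> \<le> (v + m / 2)\<^sup>2" using rel by (simp add: power2_eq_square algebra_simps)
  finally have "s * (H + g) + \<delta> / H \<le> v + m / 2"
    by (rule power2_le_imp_le) (use v m in simp)
  moreover define y where "y = H + 3 / 8 + u"
  \<comment> \<open>By \<open>c\<close> the quadratic increases from \<open>y\<close> on, so
    \<open>x\<close> may be replaced by its lower bound \<open>y\<close>.\<close>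
  have "0 \<le> (x - y) * (2 * (x + y) - (s - 1 / 2))"
    using x c unfolding s_def[symmetric] y_def[symmetric] by (intro mult_nonneg_nonneg) auto
  hence "2 * y\<^sup>2 - (s - 1 / 2) * y \<le> 2 * x\<^sup>2 - (s - 1 / 2) * x"
    by (simp add: power2_eq_square algebra_simps diff_divide_distrib)
  moreover have Hu: "H * u = (33 + 4 * m) / 128 - b / H"
    unfolding u_def using H by (simp add: power2_eq_square field_simps)
  have "2 * y\<^sup>2 - (s - 1 / 2) * y = 2 * H\<^sup>2 + 2 * H - s * H + 15 / 32 + 4 * (H * u) + 2 * u + 2 * u\<^sup>2
          - s * (3 / 8) - s * u"
    unfolding y_def by (simp add: power2_eq_square field_simps)
  moreover have "s * (1 / 8 - 1 / (2 * m)) = s * g - s * (3 / 8)"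
    unfolding g_def using m by (simp add: field_simps)
  \<comment> \<open>The terms in \<open>H\<^sup>2\<close> and \<open>H\<close> and the constants
    cancel; the remainder is the quantity in \<open>pos\<close>.\<close>
  ultimately show ?thesis
    using pos unfolding s_def[symmetric] Hu
    by (simp add: algebra_simps diff_divide_distrib add_divide_distrib)
qed

text \<open>Only \<open>B * C\<close> and \<open>B + C\<close> enter the product, and the relation
  eliminates \<open>v\<close>. The result depends on \<open>H\<close> and \<open>k\<close> alone and
  grows with \<open>k\<close>.\<close>

lemma extremal_product:
  fixes H B C v k p q r :: int
  assumes "q = H * B + 1" "r = H * C + 1"
    and "B = 2 * p - v" "C = 2 * p + v + k" "v * (v + k) = k * p - (H + 1)"
  shows "p * q * r = p * (H\<^sup>2 * (4 * p\<^sup>2 + k * p + (H + 1)) + H * (4 * p + k) + 1)"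
proof -
  have "B * C = 4 * p\<^sup>2 + 2 * p * k - v * (v + k)"
    unfolding assms(3,4) by (simp add: power2_eq_square algebra_simps)
  hence BC: "B * C = 4 * p\<^sup>2 + k * p + (H + 1)" unfolding assms(5) by simp
  have "B + C = 4 * p + k" unfolding assms(3,4) by simp
  have "q * r = H\<^sup>2 * (B * C) + H * (B + C) + 1"
    unfolding assms(1,2) by (simp add: power2_eq_square algebra_simps)
  thus ?thesis unfolding BC \<open>B + C = 4 * p + k\<close> by (simp add: mult.assoc)
qed

text \<open>Replacing \<open>k\<close> by the smaller \<open>m\<close> only lowers the product,
  while the relation becomes \<open>v * (v + m) = m * p - (H + 1) + (k - m) * (p - v)\<close>, whose
  last term is nonnegative as \<open>v <= p\<close>.\<close>

lemma extremal_bound: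
  fixes H B C v k p q r m :: int
  defines "x \<equiv> root 8 (of_int (p * q * r) / 4)"
  assumes H: "2 \<le> H" and pqr: "p = H\<^sup>2 + H + 1" "q = H * B + 1" "r = H * C + 1"
    and v: "1 \<le> v" and BC: "B = 2 * p - v" "C = 2 * p + v + k"
    and rel: "v * (v + k) = k * (H\<^sup>2 + H + 1) - (H + 1)"
    and m: "m = 3 \<or> m = 7" "m \<le> k"
  shows "of_int B < 2 * x\<^sup>2 - (sqrt (of_int m) - 1 / 2) * x
           + (1 / 2 + 3 * of_int m / 8 - sqrt (of_int m) * (1 / 8 - 1 / (2 * of_int m)))"
proof -
  \<comment> \<open>The difference \<open>\<delta> - 4 * b\<close> is 1/20 for \<open>m = 3\<close>
    and 1/2 for \<open>m = 7\<close>. The latter pays for the negative term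
    \<open>(2 - sqrt 7) * u\<close>.\<close>
  define b \<delta> :: real where "b = (if m = 3 then 3 / 16 else 3 / 8)" and "\<delta> = (if m = 3 then 4 / 5 else 2)"
  define h :: real where "h = of_int H"
  define u where "u = (33 + 4 * of_int m) / 128 / h - b / h\<^sup>2"
  have h: "2 \<le> h" unfolding h_def using H by simp
  have p0: "0 \<le> p" unfolding pqr(1) using H by simp
  have "k * (p - v) = v\<^sup>2 + (H + 1)"
    using rel unfolding pqr(1) by (simp add: power2_eq_square algebra_simps)
  hence "0 < k * (p - v)" using H zero_le_power2[of v] by linarith
  hence "v \<le> p" using m by (simp add: zero_less_mult_iff) linarith
  hence "0 \<le> (k - m) * (p - v)" using m by (intro mult_nonneg_nonneg) auto
  hence "m * (H\<^sup>2 + H + 1) - (H + 1) \<le> v * (v + m)"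
    using rel unfolding pqr(1) by (simp add: algebra_simps)
  hence "real_of_int (m * (H\<^sup>2 + H + 1) - (H + 1)) \<le> real_of_int (v * (v + m))"
    by (simp only: of_int_le_iff)
  hence rel': "of_int m * (h\<^sup>2 + h + 1) - (h + 1) \<le> of_int v * (of_int v + of_int m)"
    unfolding h_def by simp
  have "p * (H\<^sup>2 * (4 * p\<^sup>2 + m * p + (H + 1)) + H * (4 * p + m) + 1) \<le> p * q * r"
    unfolding extremal_product[OF pqr(2,3) BC rel[folded pqr(1)]]
    using p0 H m by (intro mult_left_mono add_mono mult_right_mono order_refl) auto
  hence "real_of_int (p * (H\<^sup>2 * (4 * p\<^sup>2 + m * p + (H + 1)) + H * (4 * p + m) + 1)) \<le> of_int (p * q * r)"
    by (simp only: of_int_le_iff)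
  hence "h + 3 / 8 + u \<le> x"
    unfolding x_def u_def using m(1) h
    by (intro extremal_root_lower_bound) (auto simp: h_def b_def pqr(1))
  moreover have s3: "sqrt 3 \<le> 7 / 4" and s7: "sqrt 7 \<le> 27 / 10"
    by (rule real_le_lsqrt; simp add: power2_eq_square)+
  have u: "0 \<le> u" "u \<le> (33 + 4 * of_int m) / 128 / h"
  proof -
    have "h * b \<le> h * (h * ((33 + 4 * of_int m) / 128))"
      using h m unfolding b_def by auto
    thus "0 \<le> u" unfolding u_def using h by (simp add: field_simps power2_eq_square)
    show "u \<le> (33 + 4 * of_int m) / 128 / h" unfolding u_def b_def by simp
  qed
  moreover have "0 < (\<delta> - 4 * b) / h + (2 - sqrt (of_int m)) * u + 2 * u\<^sup>2"
    using m(1)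
  proof
    assume "m = 3"
    hence "0 < (\<delta> - 4 * b) / h" "0 \<le> (2 - sqrt (of_int m)) * u"
      using h u s3 by (simp_all add: b_def \<delta>_def)
    thus ?thesis using zero_le_power2[of u] by linarith
  next
    assume m7: "m = 7"
    have "(sqrt 7 - 2) * u \<le> (7 / 10) * (61 / 128 / h)"
      using s7 u m7 by (intro mult_mono) auto
    also have "\<dots> < 1 / 2 / h" using h by (simp add: field_simps)
    finally have "0 < (\<delta> - 4 * b) / h + (2 - sqrt (of_int m)) * u"
      unfolding m7 by (simp add: b_def \<delta>_def m7 algebra_simps)
    thus ?thesis using zero_le_power2[of u] by linarith
  qed
  moreover have "sqrt (of_int m) - 1 / 2 \<le> 4 * (h + 3 / 8 + u)" using m h u s3 s7 by auto
  moreover have "2 * sqrt (of_int m) * \<delta> * (1 + (of_int m - 1) / (4 * of_int m)) + \<delta>\<^sup>2 / 4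
      \<le> (of_int m)\<^sup>2 / 4 + of_int m - 1 - (of_int m - 1)\<^sup>2 / (4 * of_int m)"
    using m s3 s7 by (auto simp: \<delta>_def power2_eq_square)
  ultimately have "2 * (h\<^sup>2 + h + 1) - of_int v < 2 * x\<^sup>2 - (sqrt (of_int m) - 1 / 2) * x
           + (1 / 2 + 3 * of_int m / 8 - sqrt (of_int m) * (1 / 8 - 1 / (2 * of_int m)))"
    unfolding u_def using h m v rel'
    by (intro extremal_real_bound[where \<delta> = \<delta> and b = b]) (auto simp: \<delta>_def)
  thus ?thesis unfolding BC(1) pqr(1) h_def by simp
qed

section \<open>Both bounds from the generic and the extremal case\<close>

theorem theorem4p8:
  shows "(\<forall>n p q r. K3N n p q r \<longrightarrow>
            K3N_B p q r
              < sqrt 2 * root 4 (real n) - (sqrt 3 - 1 / 2) * root 8 (real n / 4)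
                + (39 + sqrt 3) / 24) \<and>
         (\<forall>n p q r. C3N n p q r \<and> n \<noteq> 6601 \<longrightarrow>
            K3N_B p q r
              < sqrt 2 * root 4 (real n) - (sqrt 7 - 1 / 2) * root 8 (real n / 4)
                + (175 - 3 * sqrt 7) / 56)"
proof (intro conjI allI impI)
  fix n p q r
  assume K: "K3N n p q r"
  hence n: "real n = of_int (int p * int q * int r)" by (simp add: K3N_def)
  from K show "K3N_B p q r < sqrt 2 * root 4 (real n) - (sqrt 3 - 1 / 2) * root 8 (real n / 4)
      + (39 + sqrt 3) / 24"
  proof (cases rule: K3N_cases)
    case (generic B)
    have "real_of_int (3 * B ^ 4) < real_of_int (5 * int n)" using generic(2) by (simp only: of_int_less_iff)
    hence "3 * (of_int B) ^ 4 < 5 * real n" by simp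
    moreover have s: "17 / 10 \<le> sqrt 3" "sqrt 3 \<le> 174 / 100"
      by (rule real_le_rsqrt real_le_lsqrt; simp add: power2_eq_square)+
    have "(sqrt 3 - 1 / 2)\<^sup>2 < 393 / 250 * ((39 + sqrt 3) / 24)"
      using s by (simp add: power2_diff power_divide)
    ultimately show ?thesis
      using generic_real_bound[of "of_int B" "real n"] unfolding generic(1) sqrt2_root4_eq[of "real n", simplified]
      by simp
  next
    case (extremal H B C v k)
    \<comment> \<open>At \<open>m = 3\<close> the constant is 13/8 + \<open>sqrt 3 / 24\<close>, as
      claimed.\<close>
    from extremal_bound[OF extremal(3,5,6,7,8,11,12,13), of 3] extremal(9)
    show ?thesis unfolding extremal(1) n sqrt2_root4_eq[of "real n", simplified, unfolded n]
      by (simp add: field_simps)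
  qed
next
  fix n p q r
  assume C: "C3N n p q r \<and> n \<noteq> 6601"
  hence K: "K3N n p q r" and pr: "prime (int p)" "prime (int q)" and pq: "int p < int q"
    by (auto simp: C3N_def K3N_def)
  hence n: "int n = int p * int q * int r" by (simp add: K3N_def)
  hence n': "real n = of_int (int p * int q * int r)" by (metis of_int_of_nat_eq)
  from C n have ne: "int p * int q * int r \<noteq> 6601" by linarith
  from K show "K3N_B p q r < sqrt 2 * root 4 (real n) - (sqrt 7 - 1 / 2) * root 8 (real n / 4)
      + (175 - 3 * sqrt 7) / 56"
  proof (cases rule: K3N_cases)
    case (generic B)
    have "real_of_int (3 * B ^ 4) < real_of_int (5 * int n)" using generic(2) by (simp only: of_int_less_iff)
    hence "3 * (of_int B) ^ 4 < 5 * real n" by simp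
    moreover have s: "2645 / 1000 \<le> sqrt 7" "sqrt 7 \<le> 2646 / 1000"
      by (rule real_le_rsqrt real_le_lsqrt; simp add: power2_eq_square)+
    have "(sqrt 7 - 1 / 2)\<^sup>2 < 393 / 250 * ((175 - 3 * sqrt 7) / 56)"
      using s by (simp add: power2_diff power_divide)
    ultimately show ?thesis
      using generic_real_bound[of "of_int B" "real n"] unfolding generic(1) sqrt2_root4_eq[of "real n", simplified]
      by simp
  next
    case (extremal H B C v k)
    have "7 \<le> k"
      by (rule extremal_primes[OF pr extremal(2-13) ne pq])
    \<comment> \<open>At \<open>m = 7\<close> the constant is 25/8 - \<open>3 * sqrt 7 / 56\<close>,
      as claimed.\<close>
    from extremal_bound[OF extremal(3,5,6,7,8,11,12,13) _ this]
    show ?thesis unfolding extremal(1) n' sqrt2_root4_eq[of "real n", simplified, unfolded n']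
      by (simp add: field_simps)
  qed
qed

end
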